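(* Let $(b,c)$ be a connected graph over the countably infinite set $X$. Then the following assertions are equivalent: (i) $\widetilde D_0\subseteq C_0(X)$. (ii) There exists $C\ge 0$ with $\|\varphi\|_\infty\le C\,\widetilde Q^{1/2}(\varphi)$ for all $\varphi\in C_c(X)$. (ii$'$) For one (equivalently, for all) $o\in X$ there exists $C_o\ge 0$ with $\|\varphi\|_\infty\le C_o\|\varphi\|_o$ for all $\varphi\in C_c(X)$. (iii) $D(Q_m^{(D)})\subseteq C_0(X)$ for every measure $m$ on $X$ of full support. (iii$'$) $D(Q_m^{(D)})\subseteq C_0(X)$ for every measure $m$ on $X$ of full support with $m(X)<\infty$. (iv) $\inf_{x\in X}\mathrm{cap}(x)>0$.
   Context: $X$ is a countably infinite set, $C(X)$ the real-valued functions on $X$, $C_c(X)$ those with finite support, $\|f\|_\infty=\sup_X|f|$, and $C_0(X)$ is the closure of $C_c(X)$ with respect to $\|\cdot\|_\infty$. A graph $(b,c)$ over $X$ consists of a symmetric $b:X\times X\to[0,\infty)$ with zero diagonal and $\sum_{y}b(x,y)<\infty$ for all $x$, and an arbitrary $c:X\to[0,\infty)$. It is connected if for any two distinct $x,y\in X$ there are $x=x_0,\dots,x_n=y$ with $b(x_{i-1},x_i)>0$ for $i=1,\dots,n$. For $f\in C(X)$ put $\widetilde Q(f)=\frac12\sum_{x,y}b(x,y)|f(x)-f(y)|^2+\sum_x c(x)|f(x)|^2\in[0,\infty]$ and $\widetilde D=\{f\in C(X):\widetilde Q(f)<\infty\}$. For $o\in X$ and $f\in\widetilde D$ put $\|f\|_o=(\widetilde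 Q(f)+|f(o)|^2)^{1/2}$; for connected graphs this is a norm on $\widetilde D$, and the norms for different $o$ are equivalent. $\widetilde D_0$ is the closure of $C_c(X)$ in $\widetilde D$ with respect to $\|\cdot\|_o$ (independent of $o$). The capacity of a point is $\mathrm{cap}(x)=\inf\{\widetilde Q(\varphi):\varphi\in C_c(X),\ \varphi(x)=1\}$. A measure $m$ of full support is given by $m:X\to(0,\infty)$ via $m(A)=\sum_{x\in A}m(x)$; $D(Q_m^{(D)})$ is the closure of $C_c(X)$ in $\widetilde D\cap\ell^2(X,m)$ with respect to the norm $u\mapsto(\widetilde Q(u)+\|u\|_{\ell^2(X,m)}^2)^{1/2}$. *)

theory Defs
  imports "HOL-Analysis.Analysis"
begin

text \<open>
  The vertex set X is the universe of the type \<^typ>\<open>'a\<close>, so \<open>C(X)\<close> is \<^typ>\<open>'a \<Rightarrow> real\<close>.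
  All quantities that may be infinite (energies, norms, masses, capacities) take values in
  \<^typ>\<open>ennreal\<close>, where unconditional sums over nonnegative families always exist.
\<close>

definition weighted_graph :: "('a \<Rightarrow> 'a \<Rightarrow> real) \<Rightarrow> ('a \<Rightarrow> real) \<Rightarrow> bool" where
  "weighted_graph b c \<longleftrightarrow>
     (\<forall>x y. 0 \<le> b x y) \<and> (\<forall>x y. b x y = b y x) \<and> (\<forall>x. b x x = 0) \<and>
     (\<forall>x. b x summable_on UNIV) \<and> (\<forall>x. 0 \<le> c x)"

definition connected_graph :: "('a \<Rightarrow> 'a \<Rightarrow> real) \<Rightarrow> bool" where
  "connected_graph b \<longleftrightarrow>
     (\<forall>x y. x \<noteq> y \<longrightarrow>
       (\<exists>(n::nat) p. p 0 = x \<and> p n = y \<and> (\<forall>i\<in>{1..n}. 0 < b (p (i - 1)) (p i))))"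

definition ennreal_sqrt :: "ennreal \<Rightarrow> ennreal" where
  "ennreal_sqrt a = (if a = \<infinity> then \<infinity> else ennreal (sqrt (enn2real a)))"

definition sup_norm :: "('a \<Rightarrow> real) \<Rightarrow> ennreal" where
  "sup_norm f = (SUP x. ennreal \<bar>f x\<bar>)"

definition Cc :: "('a \<Rightarrow> real) set" where
  "Cc = {f. finite {x. f x \<noteq> 0}}"

text \<open>Closure of \<open>S\<close> in the ambient space \<open>E\<close> with respect to the (extended) norm \<open>N\<close>.\<close>

definition closure_wrt ::
  "(('a \<Rightarrow> real) \<Rightarrow> ennreal) \<Rightarrow> ('a \<Rightarrow> real) set \<Rightarrow> ('a \<Rightarrow> real) set \<Rightarrow> ('a \<Rightarrow> real) set" where
  "closure_wrt N E S =
     {f \<in> E. \<forall>\<epsilon>::real. 0 < \<epsilon> \<longrightarrow> (\<exists>\<phi>\<in>S. N (\<lambda>x. f x - \<phi> x) < ennreal \<epsilon>)}"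

definition C0 :: "('a \<Rightarrow> real) set" where
  "C0 = closure_wrt sup_norm UNIV Cc"

definition energy :: "('a \<Rightarrow> 'a \<Rightarrow> real) \<Rightarrow> ('a \<Rightarrow> real) \<Rightarrow> ('a \<Rightarrow> real) \<Rightarrow> ennreal" where
  "energy b c f =
     ennreal (1 / 2) * (\<Sum>\<^sub>\<infinity>(x, y)\<in>UNIV. ennreal (b x y * \<bar>f x - f y\<bar>\<^sup>2))
     + (\<Sum>\<^sub>\<infinity>x\<in>UNIV. ennreal (c x * \<bar>f x\<bar>\<^sup>2))"

definition finite_energy :: "('a \<Rightarrow> 'a \<Rightarrow> real) \<Rightarrow> ('a \<Rightarrow> real) \<Rightarrow> ('a \<Rightarrow> real) set" where
  "finite_energy b c = {f. energy b c f < \<infinity>}"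

definition point_norm ::
  "('a \<Rightarrow> 'a \<Rightarrow> real) \<Rightarrow> ('a \<Rightarrow> real) \<Rightarrow> 'a \<Rightarrow> ('a \<Rightarrow> real) \<Rightarrow> ennreal" where
  "point_norm b c z f = ennreal_sqrt (energy b c f + ennreal (\<bar>f z\<bar>\<^sup>2))"

text \<open>
  The space \<open>D\<^sub>0\<close>; the base point \<open>z\<close> is kept as a parameter. (For connected graphs
  the result does not depend on it.)
\<close>

definition D0 :: "('a \<Rightarrow> 'a \<Rightarrow> real) \<Rightarrow> ('a \<Rightarrow> real) \<Rightarrow> 'a \<Rightarrow> ('a \<Rightarrow> real) set" where
  "D0 b c z = closure_wrt (point_norm b c z) (finite_energy b c) Cc"

definition cap :: "('a \<Rightarrow> 'a \<Rightarrow> real) \<Rightarrow> ('a \<Rightarrow> real) \<Rightarrow> 'a \<Rightarrow> ennreal" where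
  "cap b c x = (INF \<phi>\<in>{\<phi> \<in> Cc. \<phi> x = 1}. energy b c \<phi>)"

text \<open>A measure of full support is represented by its (strictly positive) point masses.\<close>

definition full_support :: "('a \<Rightarrow> real) \<Rightarrow> bool" where
  "full_support m \<longleftrightarrow> (\<forall>x. 0 < m x)"

definition mass :: "('a \<Rightarrow> real) \<Rightarrow> 'a set \<Rightarrow> ennreal" where
  "mass m A = (\<Sum>\<^sub>\<infinity>x\<in>A. ennreal (m x))"

definition l2_norm_sq :: "('a \<Rightarrow> real) \<Rightarrow> ('a \<Rightarrow> real) \<Rightarrow> ennreal" where
  "l2_norm_sq m u = (\<Sum>\<^sub>\<infinity>x\<in>UNIV. ennreal (m x * \<bar>u x\<bar>\<^sup>2))"

definition l2_space :: "('a \<Rightarrow> real) \<Rightarrow> ('a \<Rightarrow> real) set" where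
  "l2_space m = {u. l2_norm_sq m u < \<infinity>}"

definition form_norm ::
  "('a \<Rightarrow> 'a \<Rightarrow> real) \<Rightarrow> ('a \<Rightarrow> real) \<Rightarrow> ('a \<Rightarrow> real) \<Rightarrow> ('a \<Rightarrow> real) \<Rightarrow> ennreal" where
  "form_norm b c m u = ennreal_sqrt (energy b c u + l2_norm_sq m u)"

definition dirichlet_domain ::
  "('a \<Rightarrow> 'a \<Rightarrow> real) \<Rightarrow> ('a \<Rightarrow> real) \<Rightarrow> ('a \<Rightarrow> real) \<Rightarrow> ('a \<Rightarrow> real) set" where
  "dirichlet_domain b c m =
     closure_wrt (form_norm b c m) (finite_energy b c \<inter> l2_space m) Cc"

end

theory Submission
  imports Defs
begin

text \<open>
  Adding a weight \<open>m\<close> to the killing term \<open>c\<close> turns the energy into the square of the form norm,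
  and adding a unit mass at \<open>z\<close> turns it into the square of the point norm; so every norm in the
  theorem is the energy of a graph with a larger killing term. If the killing term is positive
  somewhere, connectedness makes all point evaluations bounded.

  The heart is the contrapositive of (iii') to (ii'): if the sup norm is not controlled, there are
  nonnegative \<open>\<psi>\<^sub>k \<in> C\<^sub>c\<close> of energy at most \<open>8\<^sup>-\<^sup>k\<close> attaining the value \<open>1\<close>. Their sum is at least \<open>1\<close>
  at infinitely many points, and it lies in the Dirichlet domain for a finite measure \<open>m\<close> chosen small
  against the norms of the point evaluations.
  The step from (ii') to (ii) excludes recurrence: there \<open>C\<^sub>c\<close> functions with value \<open>1\<close> at \<open>w\<close> and small
  energy would be uniformly close to each other, yet approach the constant \<open>1\<close> pointwise.
\<close>

text \<open>Squared form of the sup-norm bound. Letting \<open>e\<close> run through the real upper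
  bounds of \<open>E \<phi>\<close> avoids square roots and arithmetic in \<open>ennreal\<close>; a
  function of infinite energy imposes no condition.\<close>

definition sup_controlled :: "(('a \<Rightarrow> real) \<Rightarrow> ennreal) \<Rightarrow> bool" where
  "sup_controlled E \<longleftrightarrow>
     (\<exists>K>0. \<forall>\<phi>\<in>Cc. \<forall>x. \<forall>e\<ge>0. E \<phi> \<le> ennreal e \<longrightarrow> (\<phi> x)\<^sup>2 \<le> K * e)"

text \<open>Stable under enlarging the killing term, so the lemmas below apply at once to the
  energy, to the squared point norm and to the squared form norm.\<close>

definition nonneg_weights :: "('a \<Rightarrow> 'a \<Rightarrow> real) \<Rightarrow> ('a \<Rightarrow> real) \<Rightarrow> bool" where
  "nonneg_weights b c \<longleftrightarrow> (\<forall>x y. 0 \<le> b x y) \<and> (\<forall>x. 0 \<le> c x)"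

lemma nonneg_weightsD:
  assumes "nonneg_weights b c"
  shows "0 \<le> b x y" and "0 \<le> c x"
  using assms by (auto simp: nonneg_weights_def)

section \<open>Reduction of extended-valued sums to finite partial sums\<close>

definition partial_energy ::
  "('a \<Rightarrow> 'a \<Rightarrow> real) \<Rightarrow> ('a \<Rightarrow> real) \<Rightarrow> ('a \<times> 'a) set \<Rightarrow> 'a set \<Rightarrow> ('a \<Rightarrow> real) \<Rightarrow> real" where
  "partial_energy b c F G f =
     (\<Sum>(x, y)\<in>F. b x y * (f x - f y)\<^sup>2) / 2 + (\<Sum>x\<in>G. c x * (f x)\<^sup>2)"

lemma infsum_ennreal_le_iff:
  assumes "\<And>x. 0 \<le> f x" and "0 \<le> e"
  shows "(\<Sum>\<^sub>\<infinity>x\<in>UNIV. ennreal (f x)) \<le> ennreal e \<longleftrightarrow> (\<forall>F. finite F \<longrightarrow> sum f F \<le> e)"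
proof -
  have "(\<Sum>\<^sub>\<infinity>x\<in>UNIV. ennreal (f x)) = (SUP F\<in>{F. finite F \<and> F \<subseteq> UNIV}. \<Sum>x\<in>F. ennreal (f x))"
    by (rule nonneg_infsum_complete) simp
  then show ?thesis
    using assms by (auto simp: SUP_le_iff sum_ennreal ennreal_le_iff)
qed

text \<open>The two infinite sums are suprema over independent finite sets \<open>F\<close> and
  \<open>G\<close>, so the energy is the supremum of the partial energies over all pairs. Upper
  bounds for energies thereby become inequalities between finite real sums.\<close>

lemma energy_le_iff:
  assumes G: "nonneg_weights b c" and e: "0 \<le> e"
  shows "energy b c f \<le> ennreal e \<longleftrightarrow>
    (\<forall>F G. finite F \<longrightarrow> finite G \<longrightarrow> partial_energy b c F G f \<le> e)"
proof -
  note b = nonneg_weightsD(1)[OF G] and c = nonneg_weightsD(2)[OF G]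
  define B where "B = (\<Sum>\<^sub>\<infinity>p\<in>UNIV. ennreal (case p of (x, y) \<Rightarrow> b x y * (f x - f y)\<^sup>2))"
  define D where "D = (\<Sum>\<^sub>\<infinity>x\<in>UNIV. ennreal (c x * (f x)\<^sup>2))"
  have energy: "energy b c f = ennreal (1/2) * B + D"
    unfolding energy_def B_def D_def by (simp add: case_prod_unfold)
  have B: "B = (SUP F\<in>{F. finite F}. ennreal (\<Sum>(x, y)\<in>F. b x y * (f x - f y)\<^sup>2))"
    unfolding B_def by (subst nonneg_infsum_complete) (auto simp: b intro!: SUP_cong sum_ennreal)
  have D: "D = (SUP G\<in>{G. finite G}. ennreal (\<Sum>x\<in>G. c x * (f x)\<^sup>2))"
    unfolding D_def by (subst nonneg_infsum_complete) (auto simp: c intro!: SUP_cong sum_ennreal)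
  have "energy b c f = (SUP F\<in>{F. finite F}. ennreal (1/2) * ennreal (\<Sum>(x, y)\<in>F. b x y * (f x - f y)\<^sup>2)) + D"
    unfolding energy B by (subst SUP_mult_left_ennreal) auto
  also have "\<dots> = (SUP F\<in>{F. finite F}. SUP G\<in>{G. finite G}. ennreal (1/2) * ennreal (\<Sum>(x, y)\<in>F. b x y * (f x - f y)\<^sup>2) + ennreal (\<Sum>x\<in>G. c x * (f x)\<^sup>2))"
    unfolding D
    by (subst ennreal_SUP_add_left[symmetric], force, rule SUP_cong, rule refl,
        subst ennreal_SUP_add_right[symmetric]) auto
  also have "\<dots> = (SUP F\<in>{F. finite F}. SUP G\<in>{G. finite G}. ennreal (partial_energy b c F G f))"
  proof (intro SUP_cong refl)
    fix F G
    let ?S = "\<Sum>(x, y)\<in>F. b x y * (f x - f y)\<^sup>2" and ?T = "\<Sum>x\<in>G. c x * (f x)\<^sup>2"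
    have nonneg: "0 \<le> ?S" "0 \<le> ?T" by (auto intro!: sum_nonneg simp: b c)
    have "ennreal (1/2) * ennreal ?S + ennreal ?T = ennreal (1/2 * ?S + ?T)"
      using nonneg by (subst ennreal_mult[symmetric]) (auto simp del: ennreal_half)
    then show "ennreal (1/2) * ennreal ?S + ennreal ?T = ennreal (partial_energy b c F G f)"
      by (simp add: partial_energy_def)
  qed
  finally show ?thesis
    using e by (auto simp: SUP_le_iff ennreal_le_iff)
qed

text \<open>By injectivity the exponents are distinct, so the geometric series dominates. With an
  enumeration of the vertices as \<open>n\<close> this makes the measure constructed later
  finite.\<close>

lemma sum_half_power_le:
  assumes "inj n" and "finite G"
  shows "(\<Sum>x\<in>G. (1/2::real) ^ n x) \<le> 2"
proof -
  have "(\<Sum>x\<in>G. (1/2::real) ^ n x) = (\<Sum>k\<in>n ` G. (1/2) ^ k)"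
    using assms by (subst sum.reindex) (auto intro: inj_on_subset)
  also have "\<dots> \<le> (\<Sum>k. (1/2::real) ^ k)"
    by (rule sum_le_suminf) (use assms in auto)
  finally show ?thesis
    by (simp add: suminf_geometric)
qed

section \<open>Norms, closures and $C_0$ in terms of real inequalities\<close>

lemma ennreal_sqrt_less_iff: "0 \<le> r \<Longrightarrow> ennreal_sqrt a < ennreal r \<longleftrightarrow> a < ennreal (r\<^sup>2)"
proof (cases a)
  case (real s)
  assume "0 \<le> r"
  then have "sqrt s < r \<longleftrightarrow> s < r\<^sup>2"
    using real_sqrt_less_iff[of s "r\<^sup>2"] by (simp only: real_sqrt_abs abs_of_nonneg)
  with real show ?thesis
    by (simp add: ennreal_sqrt_def ennreal_less_iff)
qed (simp add: ennreal_sqrt_def)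

text \<open>For infinite \<open>a\<close> the right side is vacuous, and the left side holds because
  \<open>C\<close> is strictly positive; with \<open>C = 0\<close> the product with infinity would
  be 0.\<close>

lemma abs_le_ennreal_sqrt_iff:
  assumes "0 < C"
  shows "ennreal \<bar>r\<bar> \<le> ennreal C * ennreal_sqrt a \<longleftrightarrow>
    (\<forall>e\<ge>0. a \<le> ennreal e \<longrightarrow> r\<^sup>2 \<le> C\<^sup>2 * e)"
proof (cases a)
  case (real s)
  have "\<bar>r\<bar> \<le> C * sqrt s \<longleftrightarrow> r\<^sup>2 \<le> C\<^sup>2 * s"
    using assms real abs_le_square_iff[of r "C * sqrt s"] by (auto simp: power_mult_distrib)
  moreover have "(\<forall>e\<ge>0. s \<le> e \<longrightarrow> r\<^sup>2 \<le> C\<^sup>2 * e) \<longleftrightarrow> r\<^sup>2 \<le> C\<^sup>2 * s"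
    using real by (meson order_refl mult_left_mono order_trans zero_le_power2)
  ultimately show ?thesis
    using assms real by (auto simp: ennreal_sqrt_def ennreal_mult[symmetric])
qed (use assms in \<open>auto simp: ennreal_sqrt_def ennreal_mult_top top_unique\<close>)

lemma sup_controlled_iff:
  "sup_controlled E \<longleftrightarrow>
     (\<exists>C\<ge>0. \<forall>\<phi>\<in>Cc. sup_norm \<phi> \<le> ennreal C * ennreal_sqrt (E \<phi>))"
proof
  assume "sup_controlled E"
  then obtain K where K: "K > 0"
    "\<And>\<phi> x e. \<phi> \<in> Cc \<Longrightarrow> e \<ge> 0 \<Longrightarrow> E \<phi> \<le> ennreal e \<Longrightarrow> (\<phi> x)\<^sup>2 \<le> K * e"
    unfolding sup_controlled_def by blast
  have "\<forall>\<phi>\<in>Cc. sup_norm \<phi> \<le> ennreal (sqrt K) * ennreal_sqrt (E \<phi>)"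
    unfolding sup_norm_def SUP_le_iff using K by (auto simp: abs_le_ennreal_sqrt_iff)
  then show "\<exists>C\<ge>0. \<forall>\<phi>\<in>Cc. sup_norm \<phi> \<le> ennreal C * ennreal_sqrt (E \<phi>)"
    using K(1) by (meson less_imp_le real_sqrt_gt_zero)
next
  assume "\<exists>C\<ge>0. \<forall>\<phi>\<in>Cc. sup_norm \<phi> \<le> ennreal C * ennreal_sqrt (E \<phi>)"
  then obtain C where C: "C \<ge> 0"
    "\<And>\<phi>. \<phi> \<in> Cc \<Longrightarrow> sup_norm \<phi> \<le> ennreal C * ennreal_sqrt (E \<phi>)" by blast
  \<comment> \<open>The given \<open>C\<close> may be 0, whereas the squared form asks for a
    positive constant; hence \<open>C + 1\<close>.\<close>
  have "ennreal \<bar>\<phi> x\<bar> \<le> ennreal (C + 1) * ennreal_sqrt (E \<phi>)" if "\<phi> \<in> Cc" for \<phi> x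
  proof -
    have "ennreal \<bar>\<phi> x\<bar> \<le> sup_norm \<phi>"
      unfolding sup_norm_def by (rule SUP_upper) simp
    also have "\<dots> \<le> ennreal C * ennreal_sqrt (E \<phi>)" using C(2) that .
    also have "\<dots> \<le> ennreal (C + 1) * ennreal_sqrt (E \<phi>)"
      by (intro mult_right_mono ennreal_leI) auto
    finally show ?thesis .
  qed
  then have "\<forall>\<phi>\<in>Cc. \<forall>x. \<forall>e\<ge>0. E \<phi> \<le> ennreal e \<longrightarrow> (\<phi> x)\<^sup>2 \<le> (C + 1)\<^sup>2 * e"
    using abs_le_ennreal_sqrt_iff[of "C + 1"] C(1) by (meson add_nonneg_pos zero_less_one)
  moreover have "(C + 1)\<^sup>2 > 0" using C(1) by (simp add: zero_less_power)
  ultimately show "sup_controlled E"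
    unfolding sup_controlled_def by blast
qed

text \<open>Since \<epsilon> is arbitrary, both the square root and the strictness of the inequality
  can be absorbed into it.\<close>

lemma closure_wrt_ennreal_sqrt_iff:
  "f \<in> closure_wrt (\<lambda>f. ennreal_sqrt (E f)) S T \<longleftrightarrow>
     f \<in> S \<and> (\<forall>\<epsilon>>0. \<exists>\<phi>\<in>T. E (\<lambda>x. f x - \<phi> x) \<le> ennreal \<epsilon>)"
proof -
  have "(\<forall>\<epsilon>>0. \<exists>\<phi>\<in>T. ennreal_sqrt (E (\<lambda>x. f x - \<phi> x)) < ennreal \<epsilon>) \<longleftrightarrow>
        (\<forall>\<epsilon>>0. \<exists>\<phi>\<in>T. E (\<lambda>x. f x - \<phi> x) \<le> ennreal \<epsilon>)" (is "?L \<longleftrightarrow> ?R")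
  proof (intro iffI allI impI)
    fix \<epsilon> :: real assume "?L" "0 < \<epsilon>"
    then obtain \<phi> where "\<phi> \<in> T" "ennreal_sqrt (E (\<lambda>x. f x - \<phi> x)) < ennreal (sqrt \<epsilon>)"
      by (meson real_sqrt_gt_zero)
    then show "\<exists>\<phi>\<in>T. E (\<lambda>x. f x - \<phi> x) \<le> ennreal \<epsilon>"
      using \<open>0 < \<epsilon>\<close> by (auto simp: ennreal_sqrt_less_iff intro!: bexI[of _ \<phi>])
  next
    fix \<epsilon> :: real assume "?R" "0 < \<epsilon>"
    then obtain \<phi> where \<phi>: "\<phi> \<in> T" "E (\<lambda>x. f x - \<phi> x) \<le> ennreal (\<epsilon>\<^sup>2 / 2)"
      by (meson half_gt_zero zero_less_power)
    have "ennreal (\<epsilon>\<^sup>2 / 2) < ennreal (\<epsilon>\<^sup>2)"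
      using \<open>0 < \<epsilon>\<close> by (simp add: ennreal_less_iff)
    with \<phi> show "\<exists>\<phi>\<in>T. ennreal_sqrt (E (\<lambda>x. f x - \<phi> x)) < ennreal \<epsilon>"
      using \<open>0 < \<epsilon>\<close> by (auto simp: ennreal_sqrt_less_iff intro!: bexI[of _ \<phi>])
  qed
  then show ?thesis unfolding closure_wrt_def by auto
qed

text \<open>A finitely supported function uniformly \<epsilon>-close to \<open>f\<close> forces
  \<bar>f\<bar> < \<epsilon> off its support. Conversely, truncating \<open>f\<close> to the finite
  set where \<bar>f\<bar> is at least \<epsilon>/2 gives an approximant.\<close>

lemma in_C0_iff: "f \<in> C0 \<longleftrightarrow> (\<forall>\<epsilon>>0. finite {x. \<epsilon> \<le> \<bar>f x\<bar>})"
proof (intro iffI allI impI)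
  fix \<epsilon> :: real assume "f \<in> C0" "0 < \<epsilon>"
  then obtain \<phi> where \<phi>: "\<phi> \<in> Cc" "sup_norm (\<lambda>x. f x - \<phi> x) < ennreal \<epsilon>"
    unfolding C0_def closure_wrt_def by blast
  have "ennreal \<bar>f x - \<phi> x\<bar> < ennreal \<epsilon>" for x
    using \<phi>(2) unfolding sup_norm_def by (meson SUP_lessD UNIV_I)
  then have "\<bar>f x - \<phi> x\<bar> < \<epsilon>" for x
    by (simp add: ennreal_less_iff)
  then have "{x. \<epsilon> \<le> \<bar>f x\<bar>} \<subseteq> {x. \<phi> x \<noteq> 0}"
    by (auto simp: not_less) (metis diff_zero not_less)
  then show "finite {x. \<epsilon> \<le> \<bar>f x\<bar>}"
    using \<phi>(1) unfolding Cc_def by (auto intro: finite_subset)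
next
  assume fin: "\<forall>\<epsilon>>0. finite {x. \<epsilon> \<le> \<bar>f x\<bar>}"
  show "f \<in> C0"
    unfolding C0_def closure_wrt_def
  proof (safe, rule UNIV_I)
    fix \<epsilon> :: real assume "0 < \<epsilon>"
    define \<phi> where "\<phi> x = (if \<epsilon> / 2 \<le> \<bar>f x\<bar> then f x else 0)" for x
    have "{x. \<phi> x \<noteq> 0} \<subseteq> {x. \<epsilon> / 2 \<le> \<bar>f x\<bar>}" by (auto simp: \<phi>_def split: if_splits)
    then have "\<phi> \<in> Cc"
      using fin[rule_format, of "\<epsilon> / 2"] \<open>0 < \<epsilon>\<close> finite_subset unfolding Cc_def by auto
    have "sup_norm (\<lambda>x. f x - \<phi> x) \<le> ennreal (\<epsilon> / 2)"
      unfolding sup_norm_def SUP_le_iff using \<open>0 < \<epsilon>\<close> by (auto simp: \<phi>_def intro!: ennreal_leI)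
    also have "\<dots> < ennreal \<epsilon>"
      using \<open>0 < \<epsilon>\<close> by (simp add: ennreal_less_iff)
    finally show "\<exists>\<phi>\<in>Cc. sup_norm (\<lambda>x. f x - \<phi> x) < ennreal \<epsilon>"
      using \<open>\<phi> \<in> Cc\<close> by blast
  qed
qed

lemma energy_add_l2_norm_sq:
  assumes "\<And>x. 0 \<le> c x" and "\<And>x. 0 \<le> m x"
  shows "energy b c f + l2_norm_sq m f = energy b (\<lambda>x. c x + m x) f"
proof -
  have "(\<Sum>\<^sub>\<infinity>x\<in>UNIV. ennreal (c x * \<bar>f x\<bar>\<^sup>2)) + l2_norm_sq m f
      = (\<Sum>\<^sub>\<infinity>x\<in>UNIV. ennreal (c x * \<bar>f x\<bar>\<^sup>2) + ennreal (m x * \<bar>f x\<bar>\<^sup>2))"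
    unfolding l2_norm_sq_def by (rule infsum_add[symmetric]) (auto intro: nonneg_summable_on_complete)
  also have "\<dots> = (\<Sum>\<^sub>\<infinity>x\<in>UNIV. ennreal ((c x + m x) * \<bar>f x\<bar>\<^sup>2))"
    using assms by (intro infsum_cong) (simp add: ennreal_plus[symmetric] distrib_right del: ennreal_plus)
  finally show ?thesis
    unfolding energy_def by (simp add: add.assoc)
qed

lemma point_norm_eq:
  assumes "\<And>x. 0 \<le> c x"
  shows "point_norm b c z f = ennreal_sqrt (energy b (\<lambda>x. c x + indicator {z} x) f)"
proof -
  have "l2_norm_sq (indicator {z}) f = (\<Sum>\<^sub>\<infinity>x\<in>{z}. ennreal (\<bar>f x\<bar>\<^sup>2))"
    unfolding l2_norm_sq_def by (rule infsum_cong_neutral) auto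
  also have "\<dots> = ennreal (\<bar>f z\<bar>\<^sup>2)" by simp
  finally show ?thesis
    unfolding point_norm_def using assms by (simp add: energy_add_l2_norm_sq[symmetric])
qed

lemma form_norm_eq:
  assumes "\<And>x. 0 \<le> c x" and "\<And>x. 0 \<le> m x"
  shows "form_norm b c m f = ennreal_sqrt (energy b (\<lambda>x. c x + m x) f)"
  unfolding form_norm_def using assms by (simp add: energy_add_l2_norm_sq)

section \<open>Algebra of $C_c$ and basic energy estimates\<close>

lemma Cc_diff: "f \<in> Cc \<Longrightarrow> g \<in> Cc \<Longrightarrow> (\<lambda>x. f x - g x) \<in> Cc"
  unfolding Cc_def by (auto intro: finite_subset[of _ "{x. f x \<noteq> 0} \<union> {x. g x \<noteq> 0}"])

lemma Cc_scale: "f \<in> Cc \<Longrightarrow> (\<lambda>x. t * f x) \<in> Cc"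
  unfolding Cc_def by (auto intro: finite_subset[of _ "{x. f x \<noteq> 0}"])

lemma Cc_abs: "f \<in> Cc \<Longrightarrow> (\<lambda>x. \<bar>f x\<bar>) \<in> Cc"
  unfolding Cc_def by auto

lemma Cc_sum: "(\<And>k. f k \<in> Cc) \<Longrightarrow> finite A \<Longrightarrow> (\<lambda>x. \<Sum>k\<in>A. f k x) \<in> Cc"
  unfolding Cc_def
  by (auto intro!: finite_subset[of "{x. (\<Sum>k\<in>A. f k x) \<noteq> 0}" "\<Union>k\<in>A. {x. f k x \<noteq> 0}"]
      intro: sum.neutral)

lemma square_add_le: "(s + t)\<^sup>2 \<le> 2 * s\<^sup>2 + 2 * (t::real)\<^sup>2"
  using sum_squares_bound[of s t] by (simp add: power2_sum)

lemma energy_mono_killing: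
  assumes "\<And>x. c x \<le> c' x"
  shows "energy b c f \<le> energy b c' f"
  unfolding energy_def
  by (intro add_left_mono infsum_mono nonneg_summable_on_complete ennreal_leI mult_right_mono assms) auto

lemma partial_energy_le:
  assumes G: "nonneg_weights b c"
    and "energy b c f \<le> ennreal e" "0 \<le> e" "finite F" "finite G"
  shows "partial_energy b c F G f \<le> e"
  using assms by (simp add: energy_le_iff)

text \<open>The inequality (s + t)^2 \<le> 2 s^2 + 2 t^2 is applied to every term. The resulting
  factor 2 is harmless later and takes the place of the triangle inequality for the square root of
  the energy.\<close>

lemma energy_add:
  assumes G: "nonneg_weights b c"
    and f: "energy b c f \<le> ennreal e" "0 \<le> e" and g: "energy b c g \<le> ennreal e'" "0 \<le> e'"
  shows "energy b c (\<lambda>x. f x + g x) \<le> ennreal (2 * e + 2 * e')"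
proof -
  have "partial_energy b c F G (\<lambda>x. f x + g x) \<le> 2 * e + 2 * e'" if "finite F" "finite G" for F G
  proof -
    have 1: "b x y * (f x + g x - (f y + g y))\<^sup>2 \<le> 2 * (b x y * (f x - f y)\<^sup>2) + 2 * (b x y * (g x - g y)\<^sup>2)" for x y
      using mult_left_mono[OF square_add_le[of "f x - f y" "g x - g y"] nonneg_weightsD(1)[OF G, of x y]]
      by (simp add: algebra_simps)
    have 2: "c x * (f x + g x)\<^sup>2 \<le> 2 * (c x * (f x)\<^sup>2) + 2 * (c x * (g x)\<^sup>2)" for x
      using mult_left_mono[OF square_add_le[of "f x" "g x"] nonneg_weightsD(2)[OF G, of x]] by (simp add: algebra_simps)
    have "partial_energy b c F G (\<lambda>x. f x + g x)
        \<le> (\<Sum>(x,y)\<in>F. 2 * (b x y * (f x - f y)\<^sup>2) + 2 * (b x y * (g x - g y)\<^sup>2)) / 2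
          + (\<Sum>x\<in>G. 2 * (c x * (f x)\<^sup>2) + 2 * (c x * (g x)\<^sup>2))"
      unfolding partial_energy_def
      by (intro add_mono divide_right_mono sum_mono) (auto intro: 1 2)
    also have "\<dots> = 2 * partial_energy b c F G f + 2 * partial_energy b c F G g"
      unfolding partial_energy_def
      by (simp add: sum.distrib case_prod_unfold sum_distrib_left[symmetric] add_divide_distrib)
    also have "\<dots> \<le> 2 * e + 2 * e'"
      using partial_energy_le[OF G f that] partial_energy_le[OF G g that] by simp
    finally show ?thesis .
  qed
  then show ?thesis using f g by (subst energy_le_iff[OF G]) auto
qed

lemma energy_scale:
  assumes G: "nonneg_weights b c"
    and f: "energy b c f \<le> ennreal e" "0 \<le> e"
  shows "energy b c (\<lambda>x. t * f x) \<le> ennreal (t\<^sup>2 * e)"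
proof -
  have "partial_energy b c F G (\<lambda>x. t * f x) = t\<^sup>2 * partial_energy b c F G f" for F G
    unfolding partial_energy_def
    by (simp add: right_diff_distrib[symmetric] power_mult_distrib sum_distrib_left case_prod_unfold
        distrib_left mult.left_commute)
  then show ?thesis
    using f partial_energy_le[OF G f] by (subst energy_le_iff[OF G]) (auto intro: mult_left_mono)
qed

lemma energy_diff:
  assumes G: "nonneg_weights b c"
    and "energy b c f \<le> ennreal e" "0 \<le> e" "energy b c g \<le> ennreal e'" "0 \<le> e'"
  shows "energy b c (\<lambda>x. f x - g x) \<le> ennreal (2 * e + 2 * e')"
  using energy_add[OF assms(1-3), of "\<lambda>x. (-1) * g x" e'] energy_scale[OF G assms(4,5), of "-1"] assms
  by simp

text \<open>Termwise from the reverse triangle inequality: taking absolute values is a contraction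
  of the real line.\<close>

lemma energy_abs:
  assumes "nonneg_weights b c"
  shows "energy b c (\<lambda>x. \<bar>f x\<bar>) \<le> energy b c f"
  unfolding energy_def case_prod_unfold
  by (intro add_mono mult_left_mono infsum_mono nonneg_summable_on_complete ennreal_leI
      mult_left_mono power_mono nonneg_weightsD[OF assms]) auto

text \<open>Fatou's lemma in finite form: each partial energy is a finite sum, hence converges along
  pointwise limits, and the bound \<open>e\<close> passes to the limit.\<close>

lemma energy_lsc:
  assumes G: "nonneg_weights b c"
    and "\<And>x. (\<lambda>n. f n x) \<longlonglongrightarrow> g x" and "\<And>n. energy b c (f n) \<le> ennreal e" "0 \<le> e"
  shows "energy b c g \<le> ennreal e"
proof -
  have "partial_energy b c F G g \<le> e" if "finite F" "finite G" for F G
  proof (rule LIMSEQ_le_const2)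
    show "(\<lambda>n. partial_energy b c F G (f n)) \<longlonglongrightarrow> partial_energy b c F G g"
      unfolding partial_energy_def case_prod_unfold by (intro tendsto_intros assms(2)) simp
    show "\<exists>N. \<forall>n\<ge>N. partial_energy b c F G (f n) \<le> e"
      using partial_energy_le[OF G assms(3,4) that] by blast
  qed
  then show ?thesis using assms(4) by (subst energy_le_iff[OF G]) auto
qed

section \<open>Point evaluations and approximation in energy\<close>

lemma edge_bound:
  assumes G: "nonneg_weights b c"
    and "energy b c f \<le> ennreal e" "0 \<le> e"
  shows "b x y * (f x - f y)\<^sup>2 \<le> 2 * e"
  using partial_energy_le[OF assms, of "{(x,y)}" "{}"] by (simp add: partial_energy_def)

lemma killing_bound:
  assumes G: "nonneg_weights b c"
    and "energy b c f \<le> ennreal e" "0 \<le> e"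
  shows "c x * (f x)\<^sup>2 \<le> e"
  using partial_energy_le[OF assms, of "{}" "{x}"] by (simp add: partial_energy_def)

text \<open>Telescoping along a path of positive edges from \<open>z\<close> to \<open>x\<close>:
  each edge controls the increment across it. The constant depends on the path but not on
  \<open>f\<close>.\<close>

lemma increment_bound:
  assumes G: "nonneg_weights b c"
    and "connected_graph b"
  shows "\<exists>C>0. \<forall>f. \<forall>e\<ge>0. energy b c f \<le> ennreal e \<longrightarrow> (f x - f z)\<^sup>2 \<le> C * e"
proof (cases "x = z")
  case True
  then show ?thesis by (intro exI[of _ 1]) auto
next
  case False
  then obtain n :: nat and p where p: "p 0 = z" "p n = x" "\<And>i. i \<in> {1..n} \<Longrightarrow> 0 < b (p (i - 1)) (p i)"
    using assms(2)[unfolded connected_graph_def, rule_format, of z x] by blast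
  have "\<exists>C>0. \<forall>f. \<forall>e\<ge>0. energy b c f \<le> ennreal e \<longrightarrow> (f (p k) - f z)\<^sup>2 \<le> C * e" if "k \<le> n" for k
    using that
  proof (induction k)
    case 0
    then show ?case using p(1) by (intro exI[of _ 1]) auto
  next
    case (Suc k)
    then obtain C where C: "C > 0"
      "\<And>f e. e \<ge> 0 \<Longrightarrow> energy b c f \<le> ennreal e \<Longrightarrow> (f (p k) - f z)\<^sup>2 \<le> C * e" by auto
    let ?\<beta> = "b (p k) (p (Suc k))"
    have \<beta>: "?\<beta> > 0" using p(3)[of "Suc k"] Suc.prems by simp
    \<comment> \<open>One more edge: twice the bound \<open>2 * e / ?\<beta>\<close> for its squared
      increment plus twice the inductive bound \<open>C * e\<close>.\<close>
    have "(f (p (Suc k)) - f z)\<^sup>2 \<le> (4 / ?\<beta> + 2 * C) * e" if e: "e \<ge> 0" "energy b c f \<le> ennreal e" for f e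
    proof -
      have "(f (p (Suc k)) - f z)\<^sup>2 \<le> 2 * (f (p (Suc k)) - f (p k))\<^sup>2 + 2 * (f (p k) - f z)\<^sup>2"
        using square_add_le[of "f (p (Suc k)) - f (p k)" "f (p k) - f z"] by simp
      moreover have "(f (p (Suc k)) - f (p k))\<^sup>2 \<le> 2 * e / ?\<beta>"
        using edge_bound[OF G e(2,1), of "p k" "p (Suc k)"] \<beta>
        by (simp add: field_simps power2_commute)
      moreover have "(4 / ?\<beta> + 2 * C) * e = 2 * (2 * e / ?\<beta>) + 2 * (C * e)"
        by (simp add: distrib_right)
      ultimately show ?thesis
        using C(2)[OF e] by linarith
    qed
    moreover have "4 / ?\<beta> + 2 * C > 0" using \<beta> C(1) by (simp add: add_pos_pos)
    ultimately show ?case by blast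
  qed
  from this[of n] p(2) show ?thesis by simp
qed

text \<open>The positive killing term at \<open>z\<close> bounds \<open>f z\<close> itself, and
  \<open>increment_bound\<close> carries this bound to \<open>x\<close>.\<close>

lemma evaluation_bound:
  assumes G: "nonneg_weights b c"
    and "connected_graph b" and "0 < c z"
  shows "\<exists>C>0. \<forall>f. \<forall>e\<ge>0. energy b c f \<le> ennreal e \<longrightarrow> (f x)\<^sup>2 \<le> C * e"
proof -
  obtain C where C: "C > 0"
    "\<And>f e. e \<ge> 0 \<Longrightarrow> energy b c f \<le> ennreal e \<Longrightarrow> (f x - f z)\<^sup>2 \<le> C * e"
    using increment_bound[OF assms(1,2)] by blast
  have "(f x)\<^sup>2 \<le> (2 * C + 2 / c z) * e" if e: "e \<ge> 0" "energy b c f \<le> ennreal e" for f e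
  proof -
    have "(f x)\<^sup>2 \<le> 2 * (f x - f z)\<^sup>2 + 2 * (f z)\<^sup>2"
      using square_add_le[of "f x - f z" "f z"] by simp
    moreover have "(f z)\<^sup>2 \<le> e / c z"
      using killing_bound[OF G e(2,1), of z] assms(3) by (simp add: field_simps)
    moreover have "(2 * C + 2 / c z) * e = 2 * (C * e) + 2 * (e / c z)"
      by (simp add: distrib_right)
    ultimately show ?thesis
      using C(2)[OF e] by linarith
  qed
  moreover have "2 * C + 2 / c z > 0" using assms(3) C(1) by (simp add: add_pos_pos)
  ultimately show ?thesis by blast
qed

text \<open>Sup control concerns only $C_c$, to which \<open>f - \<phi>\<close> need not belong. At
  each point \<open>x\<close> a second approximant \<psi> is therefore inserted: evaluation at
  \<open>x\<close> bounds \<open>f - \<psi>\<close> there, and sup control bounds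
  \<open>\<psi> - \<phi>\<close>. As \<phi> is chosen before \<open>x\<close>, the final estimate is
  uniform.\<close>

lemma approximable_in_C0:
  assumes G: "nonneg_weights b c"
    and conn: "connected_graph b" and z: "0 < c z" and U: "sup_controlled (energy b c)"
    and f: "\<And>\<epsilon>. 0 < \<epsilon> \<Longrightarrow> \<exists>\<phi>\<in>Cc. energy b c (\<lambda>x. f x - \<phi> x) \<le> ennreal \<epsilon>"
  shows "f \<in> C0"
  unfolding in_C0_iff
proof (intro allI impI)
  fix \<epsilon> :: real assume \<epsilon>: "0 < \<epsilon>"
  obtain K where K: "K > 0"
    "\<And>\<phi> x e. \<phi> \<in> Cc \<Longrightarrow> e \<ge> 0 \<Longrightarrow> energy b c \<phi> \<le> ennreal e \<Longrightarrow> (\<phi> x)\<^sup>2 \<le> K * e"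
    using U unfolding sup_controlled_def by blast
  \<comment> \<open>Chosen so that \<open>K * (4 * \<delta>)\<close> equals \<epsilon>^2/8. Two
    squares of size at most \<epsilon>^2/8 then combine to at most \<epsilon>^2/2.\<close>
  define \<delta> where "\<delta> = \<epsilon>\<^sup>2 / (32 * K)"
  have \<delta>: "\<delta> > 0" using \<epsilon> K(1) by (simp add: \<delta>_def)
  obtain \<phi> where \<phi>: "\<phi> \<in> Cc" "energy b c (\<lambda>x. f x - \<phi> x) \<le> ennreal \<delta>"
    using f[OF \<delta>] by blast
  have "\<bar>f x - \<phi> x\<bar> < \<epsilon>" for x
  proof -
    obtain C where C: "C > 0"
      "\<And>f e. e \<ge> 0 \<Longrightarrow> energy b c f \<le> ennreal e \<Longrightarrow> (f x)\<^sup>2 \<le> C * e"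
      using evaluation_bound[OF G conn z, of x] by blast
    \<comment> \<open>The constant \<open>C\<close> depends on \<open>x\<close>, and so may \<eta>
      and \<psi>; the bound \<eta> \<le> \<delta> keeps the energy of \<open>\<psi> - \<phi>\<close>
      independent of \<open>x\<close>.\<close>
    define \<eta> where "\<eta> = min \<delta> (\<epsilon>\<^sup>2 / (8 * C))"
    have \<eta>: "\<eta> > 0" "\<eta> \<le> \<delta>" "\<eta> \<le> \<epsilon>\<^sup>2 / (8 * C)" using \<delta> \<epsilon> C(1) by (auto simp: \<eta>_def)
    obtain \<psi> where \<psi>: "\<psi> \<in> Cc" "energy b c (\<lambda>x. f x - \<psi> x) \<le> ennreal \<eta>"
      using f[OF \<eta>(1)] by blast
    have "(f x - \<psi> x)\<^sup>2 \<le> C * \<eta>" using C(2)[OF _ \<psi>(2)] \<eta> by simp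
    also have "\<dots> \<le> \<epsilon>\<^sup>2 / 8"
      using \<eta>(3) C(1) by (simp add: field_simps)
    finally have 1: "(f x - \<psi> x)\<^sup>2 \<le> \<epsilon>\<^sup>2 / 8" .
    have "energy b c (\<lambda>x. \<psi> x - \<phi> x) \<le> ennreal (2 * \<delta> + 2 * \<eta>)"
      using energy_diff[OF G \<phi>(2) _ \<psi>(2)] \<delta> \<eta> by simp
    then have "(\<psi> x - \<phi> x)\<^sup>2 \<le> K * (2 * \<delta> + 2 * \<eta>)"
      using K(2)[OF Cc_diff[OF \<psi>(1) \<phi>(1)]] \<delta> \<eta> by simp
    also have "\<dots> \<le> K * (4 * \<delta>)" using \<eta> K(1) by (intro mult_left_mono) auto
    also have "\<dots> = \<epsilon>\<^sup>2 / 8" using K(1) by (simp add: \<delta>_def)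
    finally have "(f x - \<phi> x)\<^sup>2 \<le> 2 * (\<epsilon>\<^sup>2 / 8) + 2 * (\<epsilon>\<^sup>2 / 8)"
      using 1 square_add_le[of "f x - \<psi> x" "\<psi> x - \<phi> x"] by simp
    also have "\<dots> < \<epsilon>\<^sup>2" using \<epsilon> by simp
    finally show ?thesis
      using \<epsilon> abs_square_less_1 power2_less_imp_less[of "\<bar>f x - \<phi> x\<bar>" \<epsilon>] by simp
  qed
  then have "{x. \<epsilon> \<le> \<bar>f x\<bar>} \<subseteq> {x. \<phi> x \<noteq> 0}"
    by (auto simp: not_less) (metis diff_zero not_less)
  then show "finite {x. \<epsilon> \<le> \<bar>f x\<bar>}"
    using \<phi>(1) unfolding Cc_def by (auto intro: finite_subset)
qed

section \<open>A function outside $C_0$ when sup control fails\<close>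

lemma energy_sum_geometric:
  assumes G: "nonneg_weights b c"
    and "\<And>k. energy b c (\<psi> k) \<le> ennreal (a * (1/8) ^ k)" and "0 \<le> a"
  shows "energy b c (\<lambda>x. \<Sum>k\<in>{n..<n+j}. \<psi> k x) \<le> ennreal (4 * a * (1/8) ^ n)"
proof (induction j arbitrary: n)
  case 0
  have "energy b c (\<lambda>x. 0) = 0" by (simp add: energy_def case_prod_unfold)
  then show ?case by simp
next
  case (Suc j)
  \<comment> \<open>Splitting off the first summand doubles both bounds, but the ratio 1/8 outweighs
    this: in units of \<open>a * (1/8) ^ n\<close> the total is 2 + 2 * 4/8 = 3, which is below
    4.\<close>
  have "energy b c (\<lambda>x. \<psi> n x + (\<Sum>k\<in>{Suc n..<Suc n+j}. \<psi> k x))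
      \<le> ennreal (2 * (a * (1/8) ^ n) + 2 * (4 * a * (1/8) ^ Suc n))"
    using assms(3) by (intro energy_add assms(1,2) Suc.IH) auto
  also have "\<dots> \<le> ennreal (4 * a * (1/8) ^ n)"
    using assms(3) by (intro ennreal_leI) (simp add: mult.commute)
  finally show ?case
    by (subst sum.atLeast_Suc_lessThan) auto
qed

text \<open>Failure of the bound with constant 8^k at some \<phi> and \<open>x\<close> says that the
  energy of \<phi> is small relative to the square of \<open>\<phi> x\<close>; taking absolute
  values and normalising at \<open>x\<close> gives \<psi>.\<close>

lemma concentrated_functions:
  assumes G: "nonneg_weights b c"
    and "\<not> sup_controlled (energy b c)"
  obtains \<psi> x where "\<And>k. \<psi> k \<in> Cc" "\<And>k y. 0 \<le> \<psi> k y" "\<And>k. \<psi> k (x k) = 1"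
    "\<And>k::nat. energy b c (\<psi> k) \<le> ennreal ((1/8) ^ k)"
proof -
  have "\<exists>\<psi>\<in>Cc. (\<forall>y. 0 \<le> \<psi> y) \<and> (\<exists>x. \<psi> x = 1) \<and> energy b c \<psi> \<le> ennreal ((1/8) ^ k)" for k :: nat
  proof -
    obtain \<phi> x e where \<phi>: "\<phi> \<in> Cc" "e \<ge> 0" "energy b c \<phi> \<le> ennreal e" "8 ^ k * e < (\<phi> x)\<^sup>2"
      using assms unfolding sup_controlled_def by (metis not_le zero_less_numeral zero_less_power)
    have nz: "\<phi> x \<noteq> 0"
      using \<phi>(4) mult_nonneg_nonneg[OF _ \<phi>(2), of "8 ^ k"] by auto
    let ?\<psi> = "\<lambda>y. (1 / \<bar>\<phi> x\<bar>) * \<bar>\<phi> y\<bar>"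
    have "energy b c ?\<psi> \<le> ennreal ((1 / \<bar>\<phi> x\<bar>)\<^sup>2 * e)"
      by (intro energy_scale G \<phi>(2) order_trans[OF energy_abs[OF G] \<phi>(3)])
    also have "\<dots> \<le> ennreal ((1/8) ^ k)"
      using \<phi>(4) nz by (intro ennreal_leI) (simp add: field_simps power_divide)
    finally show ?thesis
      using nz by (intro bexI[of _ ?\<psi>] Cc_scale Cc_abs \<phi>(1)) auto
  qed
  then show thesis using that by metis
qed

lemma not_sup_controlled_witness:
  fixes b :: "'a \<Rightarrow> 'a \<Rightarrow> real"
  assumes G: "nonneg_weights b c"
    and count: "countable (UNIV :: 'a set)" and conn: "connected_graph b" and z: "0 < c z"
    and U: "\<not> sup_controlled (energy b c)"
  shows "\<exists>m f. full_support m \<and> mass m UNIV < \<infinity> \<and>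
    energy b (\<lambda>x. c x + m x) f < \<infinity> \<and>
    (\<forall>\<epsilon>>0. \<exists>\<phi>\<in>Cc. energy b (\<lambda>x. c x + m x) (\<lambda>x. f x - \<phi> x) \<le> ennreal \<epsilon>) \<and> f \<notin> C0"
proof -
  obtain \<psi> p where \<psi>: "\<And>k. \<psi> k \<in> Cc" "\<And>k y. 0 \<le> \<psi> k y" "\<And>k. \<psi> k (p k) = 1"
    "\<And>k::nat. energy b c (\<psi> k) \<le> ennreal ((1/8) ^ k)"
    using concentrated_functions[OF G U] by metis
  obtain C where C: "\<And>x. C x > 0"
    "\<And>x f e. e \<ge> 0 \<Longrightarrow> energy b c f \<le> ennreal e \<Longrightarrow> (f x)\<^sup>2 \<le> C x * e"
    using evaluation_bound[OF G conn z] by metis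
  obtain N :: "'a \<Rightarrow> nat" where N: "inj N" using count by (auto simp: countable_def)
  \<comment> \<open>The factor (1/2)^\<open>N x\<close> is summable over the vertices. Dividing by
    \<open>C x + 1\<close> cancels the evaluation constant, so the squared l2 norm is at most twice
    any energy bound; the summand 1 also gives \<open>m x\<close> \<le> (1/2)^\<open>N x\<close>,
    hence finite mass.\<close>
  define m where "m x = (1/2) ^ N x / (C x + 1)" for x
  have m_pos: "0 < m x" for x
    using C(1)[of x] by (simp add: m_def)
  have m_C: "m x * (C x * e) \<le> (1/2) ^ N x * e" if "0 \<le> e" for x e
  proof -
    have "m x * (C x * e) = (1/2) ^ N x * e * (C x / (C x + 1))" by (simp add: m_def)
    also have "\<dots> \<le> (1/2) ^ N x * e * 1"
      using C(1)[of x] that by (intro mult_left_mono) (auto simp: field_simps)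
    finally show ?thesis by simp
  qed
  have l2: "l2_norm_sq m f \<le> ennreal (2 * e)" if e: "0 \<le> e" "energy b c f \<le> ennreal e" for f e
  proof -
    have "(\<Sum>x\<in>G. m x * (f x)\<^sup>2) \<le> 2 * e" if "finite G" for G
    proof -
      have "m x * (f x)\<^sup>2 \<le> (1/2) ^ N x * e" for x
        using mult_left_mono[OF C(2)[OF e, of x], of "m x"] m_pos[of x] m_C[OF e(1), of x] by linarith
      then have "(\<Sum>x\<in>G. m x * (f x)\<^sup>2) \<le> (\<Sum>x\<in>G. (1/2) ^ N x) * e"
        by (simp add: sum_distrib_right sum_mono)
      also have "\<dots> \<le> 2 * e"
        using sum_half_power_le[OF N that] e(1) by (rule mult_right_mono)
      finally show ?thesis .
    qed
    then show ?thesis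
      unfolding l2_norm_sq_def using m_pos e
      by (subst infsum_ennreal_le_iff) (auto intro!: mult_nonneg_nonneg intro: less_imp_le)
  qed
  have mass: "mass m UNIV \<le> ennreal 2"
    unfolding mass_def
  proof (subst infsum_ennreal_le_iff)
    have "m x \<le> (1/2) ^ N x" for x
      using C(1)[of x] frac_le[of "(1/2) ^ N x" "(1/2) ^ N x" 1 "C x + 1"] by (simp add: m_def)
    then show "\<forall>F. finite F \<longrightarrow> sum m F \<le> 2"
      by (blast intro: order_trans[OF sum_mono sum_half_power_le[OF N]])
  qed (use m_pos in \<open>auto intro: less_imp_le\<close>)
  have M: "nonneg_weights b (\<lambda>x. c x + m x)"
    using G m_pos by (auto simp: nonneg_weights_def less_imp_le intro!: add_nonneg_nonneg)
  have E: "energy b (\<lambda>x. c x + m x) (\<psi> k) \<le> ennreal (3 * (1/8) ^ k)" for k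
  proof -
    have "energy b (\<lambda>x. c x + m x) (\<psi> k) = energy b c (\<psi> k) + l2_norm_sq m (\<psi> k)"
      using nonneg_weightsD(2)[OF G] m_pos by (intro energy_add_l2_norm_sq[symmetric]) (auto intro: less_imp_le)
    also have "\<dots> \<le> ennreal ((1/8) ^ k) + ennreal (2 * (1/8) ^ k)"
      by (intro add_mono \<psi>(4) l2) auto
    also have "\<dots> = ennreal (3 * (1/8) ^ k)"
      by (subst ennreal_plus[symmetric]) auto
    finally show ?thesis .
  qed
  define f where "f x = (\<Sum>k. \<psi> k x)" for x
  \<comment> \<open>The evaluation bound at \<open>x\<close> turns the geometric decay of the
    energies into geometric decay of the values, with ratio \<open>sqrt (1/8)\<close>.\<close>
  have summable: "summable (\<lambda>k. \<psi> k x)" for x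
  proof (rule summable_comparison_test')
    show "summable (\<lambda>k. sqrt (C x) * sqrt (1/8) ^ k)"
      by (intro summable_mult summable_geometric) (simp add: real_sqrt_lt_1_iff)
    show "norm (\<psi> k x) \<le> sqrt (C x) * sqrt (1/8) ^ k" for k
      using real_sqrt_le_mono[OF C(2)[OF _ \<psi>(4), of k x]] \<psi>(2)[of k x]
      by (simp add: real_sqrt_mult real_sqrt_power real_sqrt_divide)
  qed
  \<comment> \<open>Finite blocks starting at \<open>n\<close> have energy bounded independently of
    their length (12 is 4 times 3), and lower semicontinuity passes to the full tail. The case
    \<open>n = 0\<close> gives finite energy of \<open>f\<close>.\<close>
  have tail: "energy b (\<lambda>x. c x + m x) (\<lambda>x. f x - (\<Sum>k<n. \<psi> k x)) \<le> ennreal (12 * (1/8) ^ n)" for n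
  proof (rule energy_lsc[OF M])
    show "energy b (\<lambda>x. c x + m x) (\<lambda>x. \<Sum>k\<in>{n..<n+j}. \<psi> k x) \<le> ennreal (12 * (1/8) ^ n)" for j
      using energy_sum_geometric[OF M E] by simp
    show "(\<lambda>j. \<Sum>k\<in>{n..<n+j}. \<psi> k x) \<longlonglongrightarrow> f x - (\<Sum>k<n. \<psi> k x)" for x
    proof -
      have "(\<lambda>j. \<Sum>k<j. \<psi> k x) \<longlonglongrightarrow> f x"
        unfolding f_def using summable by (rule summable_LIMSEQ)
      then have "(\<lambda>j. (\<Sum>k<n+j. \<psi> k x) - (\<Sum>k<n. \<psi> k x)) \<longlonglongrightarrow> f x - (\<Sum>k<n. \<psi> k x)"
        using LIMSEQ_ignore_initial_segment[of _ _ n]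
        by (intro tendsto_diff tendsto_const) (simp add: add.commute)
      moreover have "(\<Sum>k<n+j. \<psi> k x) - (\<Sum>k<n. \<psi> k x) = (\<Sum>k\<in>{n..<n+j}. \<psi> k x)" for j
        using sum_diff_nat_ivl[of 0 n "n+j" "\<lambda>k. \<psi> k x"] by (simp add: lessThan_atLeast0)
      ultimately show ?thesis by simp
    qed
  qed simp
  \<comment> \<open>Every \<open>p k\<close> lies in the set where \<bar>f\<bar> is at least 1. Were
    this set finite, the pointwise convergence of \<psi> to 0 would be uniform on it, contradicting
    \<open>\<psi> k (p k) = 1\<close> for some \<open>k\<close>. The points \<open>p k\<close> are
    not assumed distinct.\<close>
  have "f \<notin> C0"
  proof
    assume "f \<in> C0"
    then have "finite {x. 1 \<le> \<bar>f x\<bar>}" by (simp add: in_C0_iff)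
    moreover have "\<forall>\<^sub>F k in sequentially. \<psi> k x < 1" for x
      using summable_LIMSEQ_zero[OF summable[of x]] by (rule order_tendstoD) simp
    ultimately have "\<forall>\<^sub>F k in sequentially. \<forall>x\<in>{x. 1 \<le> \<bar>f x\<bar>}. \<psi> k x < 1"
      by (intro eventually_ball_finite ballI)
    then obtain k where k: "\<And>x. 1 \<le> \<bar>f x\<bar> \<Longrightarrow> \<psi> k x < 1"
      by (auto dest!: eventually_happens)
    have "sum (\<lambda>j. \<psi> j (p k)) {k} \<le> f (p k)"
      unfolding f_def by (rule sum_le_suminf) (auto simp: summable \<psi>(2))
    with k[of "p k"] \<psi>(3)[of k] show False by simp
  qed
  moreover have "\<exists>\<phi>\<in>Cc. energy b (\<lambda>x. c x + m x) (\<lambda>x. f x - \<phi> x) \<le> ennreal \<epsilon>" if \<epsilon>: "\<epsilon> > 0" for \<epsilon>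
  proof -
    obtain n where "(1/8) ^ n < \<epsilon> / 12" using real_arch_pow_inv[of "\<epsilon> / 12" "1/8"] \<epsilon> by auto
    then have "ennreal (12 * (1/8) ^ n) \<le> ennreal \<epsilon>" by (intro ennreal_leI) simp
    with tail[of n] show ?thesis
      by (intro bexI[of _ "\<lambda>x. \<Sum>k<n. \<psi> k x"] Cc_sum \<psi>(1)) (auto elim: order_trans)
  qed
  moreover have "energy b (\<lambda>x. c x + m x) f < \<infinity>"
    using tail[of 0] by (auto intro: le_less_trans)
  moreover have "full_support m" using m_pos by (simp add: full_support_def)
  moreover have "mass m UNIV < \<infinity>" using mass by (auto intro: le_less_trans)
  ultimately show ?thesis by blast
qed

section \<open>Removing the base point, and capacities\<close>

lemma sup_controlled_of_point:
  fixes b :: "'a \<Rightarrow> 'a \<Rightarrow> real"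
  assumes G: "nonneg_weights b c"
    and inf: "infinite (UNIV :: 'a set)" and conn: "connected_graph b"
    and U: "sup_controlled (energy b (\<lambda>x. c x + indicator {w} x))"
  shows "sup_controlled (energy b c)"
proof -
  obtain K where K: "K > 0" "\<And>\<phi> x e. \<phi> \<in> Cc \<Longrightarrow> e \<ge> 0 \<Longrightarrow>
      energy b (\<lambda>x. c x + indicator {w} x) \<phi> \<le> ennreal e \<Longrightarrow> (\<phi> x)\<^sup>2 \<le> K * e"
    using U unfolding sup_controlled_def by blast
  have K': "(\<phi> x)\<^sup>2 \<le> K * (e + (\<phi> w)\<^sup>2)" if \<phi>: "\<phi> \<in> Cc" "e \<ge> 0" "energy b c \<phi> \<le> ennreal e" for \<phi> x e
  proof (rule K(2)[OF \<phi>(1)])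
    have "energy b (\<lambda>x. c x + indicator {w} x) \<phi> = energy b c \<phi> + l2_norm_sq (indicator {w}) \<phi>"
      using nonneg_weightsD(2)[OF G] by (intro energy_add_l2_norm_sq[symmetric]) auto
    also have "l2_norm_sq (indicator {w}) \<phi> = (\<Sum>\<^sub>\<infinity>x\<in>{w}. ennreal (\<bar>\<phi> x\<bar>\<^sup>2))"
      unfolding l2_norm_sq_def by (rule infsum_cong_neutral) auto
    finally show "energy b (\<lambda>x. c x + indicator {w} x) \<phi> \<le> ennreal (e + (\<phi> w)\<^sup>2)"
      using \<phi> by (simp add: ennreal_plus add_right_mono)
  qed (use \<phi> in auto)
  \<comment> \<open>By \<open>K'\<close> it remains to bound the value at \<open>w\<close> by the
    energy alone.\<close>
  have "\<exists>L>0. \<forall>\<phi>\<in>Cc. \<forall>e\<ge>0. energy b c \<phi> \<le> ennreal e \<longrightarrow> (\<phi> w)\<^sup>2 \<le> L * e"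
  proof (rule ccontr)
    assume neg: "\<not> ?thesis"
    have small: "\<exists>\<phi>\<in>Cc. \<phi> w = 1 \<and> energy b c \<phi> \<le> ennreal \<delta>" if \<delta>: "\<delta> > 0" for \<delta>
    proof -
      obtain \<phi> e where \<phi>: "\<phi> \<in> Cc" "e \<ge> 0" "energy b c \<phi> \<le> ennreal e" "1 / \<delta> * e < (\<phi> w)\<^sup>2"
        using neg \<delta> by (metis not_le zero_less_divide_1_iff)
      have nz: "\<phi> w \<noteq> 0" using \<phi>(2,4) \<delta> by (auto simp: field_simps)
      have "energy b c (\<lambda>y. (1 / \<phi> w) * \<phi> y) \<le> ennreal ((1 / \<phi> w)\<^sup>2 * e)"
        by (intro energy_scale G \<phi>)
      also have "\<dots> \<le> ennreal \<delta>"
        using \<phi>(4) nz \<delta> by (intro ennreal_leI) (simp add: field_simps power_divide)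
      finally show ?thesis
        using nz by (intro bexI[of _ "\<lambda>y. (1 / \<phi> w) * \<phi> y"] Cc_scale \<phi>(1)) auto
    qed
    define \<delta> where "\<delta> = 1 / (32 * K)"
    have \<delta>: "\<delta> > 0" using K(1) by (simp add: \<delta>_def)
    obtain \<phi> where \<phi>: "\<phi> \<in> Cc" "\<phi> w = 1" "energy b c \<phi> \<le> ennreal \<delta>" using small[OF \<delta>] by blast
    \<comment> \<open>Here infiniteness of the vertex set enters: \<phi> is 1 at \<open>w\<close>
      but vanishes somewhere.\<close>
    obtain x where x: "\<phi> x = 0"
      using \<phi>(1) inf unfolding Cc_def by (metis (mono_tags, lifting) UNIV_eq_I mem_Collect_eq)
    obtain C where C: "C > 0"
      "\<And>f e. e \<ge> 0 \<Longrightarrow> energy b c f \<le> ennreal e \<Longrightarrow> (f x - f w)\<^sup>2 \<le> C * e"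
      using increment_bound[OF G conn] by blast
    \<comment> \<open>Now that \<open>x\<close> is fixed, \<psi> can be given so little energy that
      its value at \<open>x\<close> stays near its value 1 at \<open>w\<close>.\<close>
    define \<eta> where "\<eta> = min \<delta> (1 / (8 * C))"
    have \<eta>: "\<eta> > 0" "\<eta> \<le> \<delta>" "\<eta> \<le> 1 / (8 * C)" using \<delta> C(1) by (auto simp: \<eta>_def)
    obtain \<psi> where \<psi>: "\<psi> \<in> Cc" "\<psi> w = 1" "energy b c \<psi> \<le> ennreal \<eta>" using small[OF \<eta>(1)] by blast
    have "(\<psi> x - 1)\<^sup>2 \<le> C * \<eta>" using C(2)[OF _ \<psi>(3)] \<psi>(2) \<eta> by simp
    also have "\<dots> \<le> 1 / 8" using \<eta>(3) C(1) by (simp add: field_simps)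
    finally have 1: "(1 - \<psi> x)\<^sup>2 \<le> 1 / 8" by (simp add: power2_commute)
    \<comment> \<open>Both functions are 1 at \<open>w\<close>, so the base point term of their
      difference vanishes and only small energies remain. Hence \<open>\<psi> x\<close> is close to
      \<open>\<phi> x = 0\<close> as well as to 1, and 1 \<le> 2/8 + 2/8 is absurd.\<close>
    have "(\<psi> x - \<phi> x)\<^sup>2 \<le> K * ((2 * \<eta> + 2 * \<delta>) + (\<psi> w - \<phi> w)\<^sup>2)"
      using \<delta> \<eta> by (intro K' Cc_diff energy_diff G \<psi> \<phi>) auto
    also have "\<dots> \<le> K * (4 * \<delta>)"
      using \<eta> K(1) \<phi>(2) \<psi>(2) by (intro mult_left_mono) auto
    also have "\<dots> = 1 / 8" using K(1) by (simp add: \<delta>_def)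
    finally show False
      using 1 x square_add_le[of "1 - \<psi> x" "\<psi> x"] by simp
  qed
  then obtain L where L: "L > 0"
    "\<And>\<phi> e. \<phi> \<in> Cc \<Longrightarrow> e \<ge> 0 \<Longrightarrow> energy b c \<phi> \<le> ennreal e \<Longrightarrow> (\<phi> w)\<^sup>2 \<le> L * e" by blast
  have "(\<phi> x)\<^sup>2 \<le> (K * (1 + L)) * e" if \<phi>: "\<phi> \<in> Cc" "e \<ge> 0" "energy b c \<phi> \<le> ennreal e" for \<phi> x e
  proof -
    have "(\<phi> x)\<^sup>2 \<le> K * (e + (\<phi> w)\<^sup>2)" by (rule K'[OF \<phi>])
    also have "\<dots> \<le> K * (e + L * e)"
      using K(1) L(2)[OF \<phi>] by (intro mult_left_mono add_left_mono) auto
    finally show ?thesis by (simp add: algebra_simps)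
  qed
  moreover have "K * (1 + L) > 0" using K(1) L(1) by simp
  ultimately show ?thesis unfolding sup_controlled_def by blast
qed

text \<open>Both sides are homogeneous of degree 2: normalising \<phi> to the value 1 at
  \<open>x\<close> turns a bound with constant \<open>K\<close> into the lower bound
  1/\<open>K\<close> for the capacity, and conversely.\<close>

lemma sup_controlled_iff_cap:
  assumes G: "nonneg_weights b c"
  shows "sup_controlled (energy b c) \<longleftrightarrow> 0 < (INF x. cap b c x)"
proof
  assume "sup_controlled (energy b c)"
  then obtain K where K: "K > 0"
    "\<And>\<phi> x e. \<phi> \<in> Cc \<Longrightarrow> e \<ge> 0 \<Longrightarrow> energy b c \<phi> \<le> ennreal e \<Longrightarrow> (\<phi> x)\<^sup>2 \<le> K * e"
    unfolding sup_controlled_def by blast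
  have "ennreal (1 / K) \<le> energy b c \<phi>" if "\<phi> \<in> Cc" "\<phi> x = 1" for \<phi> x
  proof (cases "energy b c \<phi>")
    case (real e)
    then show ?thesis
      using K(2)[OF that(1), of e x] that(2) K(1) by (auto intro!: ennreal_leI simp: field_simps)
  qed simp
  then have "ennreal (1 / K) \<le> (INF x. cap b c x)"
    unfolding cap_def by (auto intro!: INF_greatest)
  moreover have "0 < ennreal (1 / K)" using K(1) by simp
  ultimately show "0 < (INF x. cap b c x)" by (rule less_le_trans[rotated])
next
  assume "0 < (INF x. cap b c x)"
  \<comment> \<open>A number strictly below the infimum is finite, so no separate argument is needed
    for finiteness of the infimum.\<close>
  then obtain t where t: "0 < t" "t < (INF x. cap b c x)"
    using dense by blast
  then obtain d where d: "t = ennreal d"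
    by (cases t) auto
  with t(1) have d0: "0 < d" by simp
  have "(\<phi> x)\<^sup>2 \<le> (1 / d) * e" if \<phi>: "\<phi> \<in> Cc" "e \<ge> 0" "energy b c \<phi> \<le> ennreal e" for \<phi> x e
  proof (cases "\<phi> x = 0")
    case False
    have "ennreal d \<le> cap b c x"
      using order_trans[OF less_imp_le[OF t(2)] INF_lower[of x UNIV "cap b c"]] by (simp add: d)
    also have "\<dots> \<le> energy b c (\<lambda>y. (1 / \<phi> x) * \<phi> y)"
      unfolding cap_def using False by (intro INF_lower) (use Cc_scale[OF \<phi>(1), of "1 / \<phi> x"] in simp)
    also have "\<dots> \<le> ennreal ((1 / \<phi> x)\<^sup>2 * e)" by (intro energy_scale G \<phi>)
    finally have "d \<le> (1 / \<phi> x)\<^sup>2 * e" using \<phi>(2) by (simp add: ennreal_le_iff)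
    then show ?thesis using False d0 by (simp add: field_simps power_divide)
  qed (use d0 \<phi> in auto)
  then show "sup_controlled (energy b c)"
    unfolding sup_controlled_def using d0 by (intro exI[of _ "1 / d"]) auto
qed

section \<open>Comparison of the domains and the equivalences\<close>

lemma sup_controlled_mono:
  assumes "sup_controlled E" and "\<And>f. E f \<le> E' f"
  shows "sup_controlled E'"
  using assms(1) order_trans[OF assms(2)] unfolding sup_controlled_def by blast

lemma dirichlet_domain_iff:
  assumes "\<And>x. 0 \<le> c x" and "full_support m"
  shows "f \<in> dirichlet_domain b c m \<longleftrightarrow> energy b (\<lambda>x. c x + m x) f < \<infinity> \<and>
    (\<forall>\<epsilon>>0. \<exists>\<phi>\<in>Cc. energy b (\<lambda>x. c x + m x) (\<lambda>x. f x - \<phi> x) \<le> ennreal \<epsilon>)"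
proof -
  have m: "0 \<le> m x" for x using assms(2) by (simp add: full_support_def less_imp_le)
  have "form_norm b c m = (\<lambda>f. ennreal_sqrt (energy b (\<lambda>x. c x + m x) f))"
    using form_norm_eq[OF assms(1) m] by (intro ext)
  moreover have "f \<in> finite_energy b c \<inter> l2_space m \<longleftrightarrow> energy b (\<lambda>x. c x + m x) f < \<infinity>"
    unfolding finite_energy_def l2_space_def
    by (simp add: energy_add_l2_norm_sq[OF assms(1) m, symmetric])
  ultimately show ?thesis
    unfolding dirichlet_domain_def by (simp only: closure_wrt_ennreal_sqrt_iff)
qed

lemma D0_iff:
  assumes "\<And>x. 0 \<le> c x"
  shows "f \<in> D0 b c z \<longleftrightarrow> energy b c f < \<infinity> \<and>
    (\<forall>\<epsilon>>0. \<exists>\<phi>\<in>Cc. energy b (\<lambda>x. c x + indicator {z} x) (\<lambda>x. f x - \<phi> x) \<le> ennreal \<epsilon>)"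
proof -
  have "point_norm b c z = (\<lambda>f. ennreal_sqrt (energy b (\<lambda>x. c x + indicator {z} x) f))"
    using point_norm_eq[OF assms] by (intro ext)
  then show ?thesis
    unfolding D0_def by (simp only: closure_wrt_ennreal_sqrt_iff finite_energy_def mem_Collect_eq)
qed

text \<open>For \<open>t = max 1 (1 / m z)\<close> the killing term with unit mass at
  \<open>z\<close> is at most \<open>t\<close> times \<open>c + m\<close>, and \<open>t\<close>
  \<ge> 1 covers the edge terms. Approximation in the form norm thus implies approximation in the
  point norm.\<close>

lemma dirichlet_domain_subset_D0:
  assumes G: "nonneg_weights b c" and m: "full_support m"
  shows "dirichlet_domain b c m \<subseteq> D0 b c z"
proof
  note b = nonneg_weightsD(1)[OF G] and c = nonneg_weightsD(2)[OF G]
  fix f assume f: "f \<in> dirichlet_domain b c m"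
  have mpos: "0 < m x" for x using m by (simp add: full_support_def)
  define t where "t = max 1 (1 / m z)"
  have t: "1 \<le> t" "1 \<le> t * m z" using mpos[of z] by (auto simp: t_def max_def field_simps)
  have P: "nonneg_weights b (\<lambda>x. c x + indicator {z} x)"
    by (auto simp: nonneg_weights_def b c)
  have M: "nonneg_weights b (\<lambda>x. c x + m x)"
    by (auto simp: nonneg_weights_def b c mpos less_imp_le)
  have le: "energy b (\<lambda>x. c x + indicator {z} x) g \<le> ennreal (t * e)"
    if e: "0 \<le> e" "energy b (\<lambda>x. c x + m x) g \<le> ennreal e" for g e
  proof -
    have "partial_energy b (\<lambda>x. c x + indicator {z} x) F G g \<le> t * e" if fin: "finite F" "finite G" for F G
    proof -
      have c_le: "c x + indicator {z} x \<le> t * (c x + m x)" for x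
        using mult_right_mono[OF t(1) c[of x]] t mpos[of x]
        by (cases "x = z") (auto simp: distrib_left intro: add_mono add_increasing2)
      have "partial_energy b (\<lambda>x. c x + indicator {z} x) F G g
          \<le> (\<Sum>(x, y)\<in>F. t * (b x y * (g x - g y)\<^sup>2)) / 2 + (\<Sum>x\<in>G. t * ((c x + m x) * (g x)\<^sup>2))"
        unfolding partial_energy_def
      proof (intro add_mono divide_right_mono sum_mono)
        show "(case p of (x, y) \<Rightarrow> b x y * (g x - g y)\<^sup>2) \<le> (case p of (x, y) \<Rightarrow> t * (b x y * (g x - g y)\<^sup>2))" for p
          using mult_right_mono[OF t(1), of "b (fst p) (snd p) * (g (fst p) - g (snd p))\<^sup>2"] b
          by (simp add: case_prod_unfold)
        show "(c x + indicator {z} x) * (g x)\<^sup>2 \<le> t * ((c x + m x) * (g x)\<^sup>2)" for x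
          using mult_right_mono[OF c_le[of x], of "(g x)\<^sup>2"] by (simp add: mult.assoc)
      qed simp
      also have "\<dots> = t * partial_energy b (\<lambda>x. c x + m x) F G g"
        unfolding partial_energy_def
        by (simp add: case_prod_unfold sum_distrib_left[symmetric] distrib_left)
      also have "\<dots> \<le> t * e"
        using partial_energy_le[OF M e(2,1) fin] t by (intro mult_left_mono) auto
      finally show ?thesis .
    qed
    then show ?thesis using t e by (subst energy_le_iff[OF P]) auto
  qed
  have "energy b c f \<le> energy b (\<lambda>x. c x + m x) f"
    by (rule energy_mono_killing) (simp add: mpos less_imp_le)
  moreover have "\<exists>\<phi>\<in>Cc. energy b (\<lambda>x. c x + indicator {z} x) (\<lambda>x. f x - \<phi> x) \<le> ennreal \<epsilon>" if "0 < \<epsilon>" for \<epsilon>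
  proof -
    have "\<epsilon> / t > 0" using that t by simp
    then obtain \<phi> where \<phi>: "\<phi> \<in> Cc" "energy b (\<lambda>x. c x + m x) (\<lambda>x. f x - \<phi> x) \<le> ennreal (\<epsilon> / t)"
      using f unfolding dirichlet_domain_iff[OF c m] by blast
    show ?thesis using le[OF _ \<phi>(2)] that t \<phi>(1) by auto
  qed
  ultimately show "f \<in> D0 b c z"
    using f unfolding dirichlet_domain_iff[OF c m] D0_iff[OF c] by (auto intro: le_less_trans)
qed

lemma D0_subset_C0:
  assumes G: "nonneg_weights b c" and conn: "connected_graph b"
    and U: "sup_controlled (energy b (\<lambda>x. c x + indicator {z} x))"
  shows "D0 b c z \<subseteq> C0"
proof
  fix f assume f: "f \<in> D0 b c z"
  note c = nonneg_weightsD(2)[OF G]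
  have P: "nonneg_weights b (\<lambda>x. c x + indicator {z} x)"
    using G by (simp add: nonneg_weights_def)
  have "0 < c z + indicator {z} z"
    using c[of z] by simp
  from approximable_in_C0[OF P conn this U] f show "f \<in> C0"
    unfolding D0_iff[OF c] by blast
qed

text \<open>The witness is built for the killing term with the unit mass at \<open>z\<close> added,
  which is positive at \<open>z\<close>. Dropping that mass only decreases energies, so the same
  \<open>m\<close> and \<open>f\<close> serve for \<open>c\<close>.\<close>

lemma dirichlet_domain_not_subset_C0:
  fixes b :: "'a \<Rightarrow> 'a \<Rightarrow> real"
  assumes G: "nonneg_weights b c" and count: "countable (UNIV :: 'a set)" and conn: "connected_graph b"
    and U: "\<not> sup_controlled (energy b (\<lambda>x. c x + indicator {z} x))"
  shows "\<exists>m. full_support m \<and> mass m UNIV < \<infinity> \<and> \<not> dirichlet_domain b c m \<subseteq> C0"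
proof -
  note c = nonneg_weightsD(2)[OF G]
  have P: "nonneg_weights b (\<lambda>x. c x + indicator {z} x)"
    using G by (simp add: nonneg_weights_def)
  have "0 < c z + indicator {z} z"
    using c[of z] by simp
  from not_sup_controlled_witness[OF P count conn this U] obtain m f
    where m: "full_support m" "mass m UNIV < \<infinity>"
      and fin: "energy b (\<lambda>x. c x + indicator {z} x + m x) f < \<infinity>"
      and approx: "\<forall>\<epsilon>>0. \<exists>\<phi>\<in>Cc. energy b (\<lambda>x. c x + indicator {z} x + m x) (\<lambda>x. f x - \<phi> x) \<le> ennreal \<epsilon>"
      and f: "f \<notin> C0"
    by blast
  have le: "energy b (\<lambda>x. c x + m x) g \<le> energy b (\<lambda>x. c x + indicator {z} x + m x) g" for g
    by (rule energy_mono_killing) simp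
  have "f \<in> dirichlet_domain b c m"
    unfolding dirichlet_domain_iff[OF c m(1)]
    using le_less_trans[OF le fin] order_trans[OF le] approx by blast
  with m f show ?thesis by blast
qed

theorem theorem2p1:
  fixes b :: "'a \<Rightarrow> 'a \<Rightarrow> real" and c :: "'a \<Rightarrow> real" and z :: 'a
  assumes "countable (UNIV :: 'a set)" and "infinite (UNIV :: 'a set)"
    and "weighted_graph b c" and "connected_graph b"
  defines "i \<equiv> D0 b c z \<subseteq> C0"
    and "ii \<equiv> (\<exists>C\<ge>0. \<forall>\<phi>\<in>Cc. sup_norm \<phi> \<le> ennreal C * ennreal_sqrt (energy b c \<phi>))"
    and "ii'_one \<equiv> (\<exists>w. \<exists>C\<ge>0. \<forall>\<phi>\<in>Cc. sup_norm \<phi> \<le> ennreal C * point_norm b c w \<phi>)"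
    and "ii'_all \<equiv> (\<forall>w. \<exists>C\<ge>0. \<forall>\<phi>\<in>Cc. sup_norm \<phi> \<le> ennreal C * point_norm b c w \<phi>)"
    and "iii \<equiv> (\<forall>m. full_support m \<longrightarrow> dirichlet_domain b c m \<subseteq> C0)"
    and "iii' \<equiv> (\<forall>m. full_support m \<and> mass m UNIV < \<infinity> \<longrightarrow> dirichlet_domain b c m \<subseteq> C0)"
    and "iv \<equiv> (INF x. cap b c x) > 0"
  shows "(i \<longleftrightarrow> ii) \<and> (i \<longleftrightarrow> ii'_one) \<and> (i \<longleftrightarrow> ii'_all) \<and>
         (i \<longleftrightarrow> iii) \<and> (i \<longleftrightarrow> iii') \<and> (i \<longleftrightarrow> iv)"
proof -
  have G: "nonneg_weights b c"
    using assms(3) unfolding weighted_graph_def nonneg_weights_def by blast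
  note c = nonneg_weightsD(2)[OF G]
  let ?U = "\<lambda>c. sup_controlled (energy b c)" and ?P = "\<lambda>w x. c x + indicator {w} x"
  have ii: "ii \<longleftrightarrow> ?U c"
    unfolding ii_def by (rule sup_controlled_iff[symmetric])
  have one: "ii'_one \<longleftrightarrow> (\<exists>w. ?U (?P w))"
    unfolding ii'_one_def point_norm_eq[OF c] sup_controlled_iff ..
  have all: "ii'_all \<longleftrightarrow> (\<forall>w. ?U (?P w))"
    unfolding ii'_all_def point_norm_eq[OF c] sup_controlled_iff ..
  have "ii \<longleftrightarrow> iv"
    unfolding ii iv_def by (rule sup_controlled_iff_cap[OF G])
  moreover have "?U (?P w)" if "?U c" for w
    using that by (rule sup_controlled_mono) (rule energy_mono_killing, simp)
  then have "ii \<longrightarrow> ii'_all"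
    unfolding ii all by blast
  moreover have "ii'_all \<longrightarrow> ii'_one"
    unfolding one all by blast
  moreover have "ii'_one \<longrightarrow> ii"
    unfolding ii one using sup_controlled_of_point[OF G assms(2,4)] by blast
  moreover have "ii'_all \<longrightarrow> i"
    unfolding all i_def using D0_subset_C0[OF G assms(4)] by blast
  moreover have "i \<longrightarrow> iii"
    unfolding i_def iii_def using dirichlet_domain_subset_D0[OF G] by blast
  moreover have "iii \<longrightarrow> iii'"
    unfolding iii_def iii'_def by blast
  \<comment> \<open>Contrapositive: if control fails at every base point, its failure at any one of
    them already produces a bad finite measure. This closes the cycle through \<open>i\<close>,
    \<open>iii\<close> and \<open>iii'\<close>.\<close>
  moreover have "iii' \<longrightarrow> ii'_one"
    unfolding one iii'_def using dirichlet_domain_not_subset_C0[OF G assms(1,4)] by blast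
  ultimately show ?thesis by blast
qed

end
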